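(* Let a manifold $M$ be differentiably embedded in a finite-dimensional inner product space $\mathcal{E}$. For $x\in M$ let $\Pi^{\mathcal{E}}_x$ be the orthogonal projection from $\mathcal{E}$ to $T_xM$ under the inner product of $\mathcal{E}$. Then $x\mapsto\Pi_x^{\mathcal{E}}$ is a smooth map from $M$ to $L(\mathcal{E},\mathcal{E})$. Assume $M$ is equipped with a Riemannian metric $\langle\cdot,\cdot\rangle_R$. Then there exists a smooth operator-valued function $g:M\to L(\mathcal{E},\mathcal{E})$ such that $g_x:=g(x)$ is positive-definite for all $x\in M$ and $$\langle\eta,\xi\rangle_{R,x}=\langle\eta,g_x\xi\rangle_{\mathcal{E}}\quad\text{for all }\eta,\xi\in T_xM.$$ If $I_{\mathcal{E}}$ is the identity map of $\mathcal{E}$, one can take $g$ to be the operator defined by $$g_x\omega=(I_{\mathcal{E}}-\Pi^{\mathcal{E}}_x)\omega+g_{R,x}(\Pi_x^{\mathcal{E}}\omega),\qquad\omega\in\mathcal{E},$$ where $g_{R,x}$ is the unique self-adjoint operator on $T_xM$ such that $\langle\xi,\eta\rangle_{R,x}=\langle\xi,g_{R,x}\eta\rangle_{\mathcal{E}}$ for $\xi,\eta\in T_xM$.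
   Context: $T_xM$ is identified with a subspace of $\mathcal{E}$ via the embedding. $L(\mathcal{E},\mathcal{E})$ is the space of linear operators on $\mathcal{E}$; "positive-definite" means self-adjoint with respect to $\langle\cdot,\cdot\rangle_{\mathcal{E}}$ with $\langle\omega,g_x\omega\rangle_{\mathcal{E}}>0$ for $\omega\ne0$. The Riemannian metric $\langle\cdot,\cdot\rangle_R$ is not assumed to be induced from $\mathcal{E}$. *)

theory Defs
  imports "HOL-Analysis.Analysis"
begin

section \<open>Smooth maps between finite-dimensional spaces\<close>

(* k-fold continuous differentiability on an open set S of a finite-dimensional domain. The
   derivative is taken direction by direction, which keeps the codomain type fixed along the
   recursion; in finite dimension this is the usual notion of C^k. *)

primrec Ck_on :: "nat \<Rightarrow> 'm::real_normed_vector set \<Rightarrow> ('m \<Rightarrow> 'b::real_normed_vector) \<Rightarrow> bool"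
  where
    "Ck_on 0 S f \<longleftrightarrow> continuous_on S f"
  | "Ck_on (Suc k) S f \<longleftrightarrow>
       (\<forall>u\<in>S. f differentiable (at u)) \<and>
       (\<forall>v. Ck_on k S (\<lambda>u. frechet_derivative f (at u) v))"

definition smooth_on :: "'m::real_normed_vector set \<Rightarrow> ('m \<Rightarrow> 'b::real_normed_vector) \<Rightarrow> bool"
  where "smooth_on S f \<longleftrightarrow> (\<forall>k. Ck_on k S f)"


section \<open>Smooth manifolds and embeddings\<close>

(* A chart is a pair (U, \<phi>); only the values of \<phi> on U matter, and the inverse of \<phi> is
   inv_into U \<phi>. *)

type_synonym ('a, 'm) chart = "'a set \<times> ('a \<Rightarrow> 'm)"

definition is_chart :: "'a topology \<Rightarrow> ('a, 'm::real_normed_vector) chart \<Rightarrow> bool"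
  where "is_chart X c \<longleftrightarrow>
    (case c of (U, \<phi>) \<Rightarrow>
       openin X U \<and> open (\<phi> ` U) \<and>
       homeomorphic_map (subtopology X U) (top_of_set (\<phi> ` U)) \<phi>)"

definition smooth_atlas :: "'a topology \<Rightarrow> ('a, 'm::real_normed_vector) chart set \<Rightarrow> bool"
  where "smooth_atlas X A \<longleftrightarrow>
    (\<forall>c\<in>A. is_chart X c) \<and>
    (\<Union>(U, \<phi>)\<in>A. U) = topspace X \<and>
    (\<forall>(U, \<phi>)\<in>A. \<forall>(V, \<psi>)\<in>A. smooth_on (\<phi> ` (U \<inter> V)) (\<psi> \<circ> inv_into U \<phi>))"

(* The model space is a finite-dimensional normed space 'm rather than a type of class
   euclidean_space: the latter has positive dimension, whereas manifolds of dimension 0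
   (discrete sets of points) are to be included. *)

definition smooth_manifold :: "'a topology \<Rightarrow> ('a, 'm::real_normed_vector) chart set \<Rightarrow> bool"
  where "smooth_manifold X A \<longleftrightarrow>
    (\<exists>B::'m set. finite B \<and> span B = UNIV) \<and>
    Hausdorff_space X \<and>
    (\<exists>\<B>. countable \<B> \<and> (\<forall>V\<in>\<B>. openin X V) \<and>
       (\<forall>W x. openin X W \<and> x \<in> W \<longrightarrow> (\<exists>V\<in>\<B>. x \<in> V \<and> V \<subseteq> W))) \<and>
    smooth_atlas X A"

definition smooth_map_on_manifold ::
    "('a, 'm::real_normed_vector) chart set \<Rightarrow> ('a \<Rightarrow> 'b::real_normed_vector) \<Rightarrow> bool"
  where "smooth_map_on_manifold A f \<longleftrightarrow> (\<forall>(U, \<phi>)\<in>A. smooth_on (\<phi> ` U) (f \<circ> inv_into U \<phi>))"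

definition smooth_embedding ::
    "'a topology \<Rightarrow> ('a, 'm::real_normed_vector) chart set \<Rightarrow> ('a \<Rightarrow> 'e::real_normed_vector) \<Rightarrow> bool"
  where "smooth_embedding X A \<iota> \<longleftrightarrow>
    smooth_map_on_manifold A \<iota> \<and>
    (\<forall>(U, \<phi>)\<in>A. \<forall>x\<in>U. inj (frechet_derivative (\<iota> \<circ> inv_into U \<phi>) (at (\<phi> x)))) \<and>
    embedding_map X euclidean \<iota>"

(* The tangent space at x, identified with its image under the differential of the embedding.
   All charts around x contribute the same subspace. *)

definition tangent_space ::
    "('a, 'm::real_normed_vector) chart set \<Rightarrow> ('a \<Rightarrow> 'e::real_normed_vector) \<Rightarrow> 'a \<Rightarrow> 'e set"
  where "tangent_space A \<iota> x =
    (\<Union>(U, \<phi>)\<in>{(U, \<phi>)\<in>A. x \<in> U}. range (frechet_derivative (\<iota> \<circ> inv_into U \<phi>) (at (\<phi> x))))"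


section \<open>Riemannian metrics\<close>

definition inner_product_on :: "'e::real_vector set \<Rightarrow> ('e \<Rightarrow> 'e \<Rightarrow> real) \<Rightarrow> bool"
  where "inner_product_on T b \<longleftrightarrow>
    (\<forall>\<xi>\<in>T. \<forall>\<eta>\<in>T. \<forall>\<zeta>\<in>T. \<forall>r s. b (r *\<^sub>R \<xi> + s *\<^sub>R \<eta>) \<zeta> = r * b \<xi> \<zeta> + s * b \<eta> \<zeta>) \<and>
    (\<forall>\<xi>\<in>T. \<forall>\<eta>\<in>T. b \<xi> \<eta> = b \<eta> \<xi>) \<and>
    (\<forall>\<xi>\<in>T. \<xi> \<noteq> 0 \<longrightarrow> b \<xi> \<xi> > 0)"

(* R x is the metric on the tangent space at x; its values outside that space are irrelevant.
   Smoothness: in every chart, the coefficients of R with respect to constant coordinate fields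
   v, w are smooth functions of the coordinates. *)

definition riemannian_metric ::
    "'a topology \<Rightarrow> ('a, 'm::real_normed_vector) chart set \<Rightarrow> ('a \<Rightarrow> 'e::real_normed_vector)
      \<Rightarrow> ('a \<Rightarrow> 'e \<Rightarrow> 'e \<Rightarrow> real) \<Rightarrow> bool"
  where "riemannian_metric X A \<iota> R \<longleftrightarrow>
    (\<forall>x\<in>topspace X. inner_product_on (tangent_space A \<iota> x) (R x)) \<and>
    (\<forall>(U, \<phi>)\<in>A. \<forall>v w. smooth_on (\<phi> ` U)
       (\<lambda>u. R (inv_into U \<phi> u)
              (frechet_derivative (\<iota> \<circ> inv_into U \<phi>) (at u) v)
              (frechet_derivative (\<iota> \<circ> inv_into U \<phi>) (at u) w)))"


section \<open>Operators\<close>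

definition orthogonal_projection :: "'e::euclidean_space set \<Rightarrow> 'e \<Rightarrow>\<^sub>L 'e"
  where "orthogonal_projection T =
    (THE P. \<forall>\<omega>. blinfun_apply P \<omega> \<in> T \<and> (\<forall>\<xi>\<in>T. orthogonal (\<omega> - blinfun_apply P \<omega>) \<xi>))"

lemma orthogonal_projection_unique:
  fixes T :: "'e::euclidean_space set"
  assumes "subspace T" "p \<in> T" "q \<in> T"
    and "\<forall>\<xi>\<in>T. orthogonal (\<omega> - p) \<xi>" "\<forall>\<xi>\<in>T. orthogonal (\<omega> - q) \<xi>"
  shows "p = q"
proof -
  have "p - q \<in> T" using assms by (simp add: subspace_diff)
  then have "(\<omega> - p) \<bullet> (p - q) = 0" "(\<omega> - q) \<bullet> (p - q) = 0"
    using assms by (auto simp: orthogonal_def)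
  then have "(p - q) \<bullet> (p - q) = 0" by (simp add: inner_diff_left)
  then show ?thesis by simp
qed

lemma orthogonal_projection_props:
  fixes T :: "'e::euclidean_space set"
  assumes T: "subspace T"
  shows "blinfun_apply (orthogonal_projection T) \<omega> \<in> T"
    and "\<xi> \<in> T \<Longrightarrow> orthogonal (\<omega> - blinfun_apply (orthogonal_projection T) \<omega>) \<xi>"
proof -
  let ?Q = "\<lambda>\<omega> p. p \<in> T \<and> (\<forall>\<xi>\<in>T. orthogonal (\<omega> - p) \<xi>)"
  have "\<exists>p. ?Q \<omega> p" for \<omega>
    using orthogonal_subspace_decomp_exists[of T \<omega>] span_eq_iff[THEN iffD2, OF T]
    by (metis add_diff_cancel_left')
  then obtain p where p: "\<And>\<omega>. ?Q \<omega> (p \<omega>)" by metis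
  have eq: "p \<omega> = q" if "?Q \<omega> q" for \<omega> q
    using orthogonal_projection_unique[OF T, of "p \<omega>" q \<omega>] p[of \<omega>] that by blast
  have "linear p"
  proof (rule linearI)
    show "p (a + b) = p a + p b" for a b
    proof (rule eq, intro conjI ballI)
      show "p a + p b \<in> T" using p T by (simp add: subspace_add)
      show "orthogonal (a + b - (p a + p b)) \<xi>" if "\<xi> \<in> T" for \<xi>
        using p[of a] p[of b] that
        by (auto simp: orthogonal_def inner_diff_left inner_add_left)
    qed
    show "p (r *\<^sub>R a) = r *\<^sub>R p a" for r a
    proof (rule eq, intro conjI ballI)
      show "r *\<^sub>R p a \<in> T" using p T by (simp add: subspace_mul)
      show "orthogonal (r *\<^sub>R a - r *\<^sub>R p a) \<xi>" if "\<xi> \<in> T" for \<xi>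
        using p[of a] that by (auto simp: orthogonal_def inner_diff_left)
    qed
  qed
  then have P: "blinfun_apply (Blinfun p) = p"
    by (simp add: bounded_linear_Blinfun_apply linear_conv_bounded_linear)
  have "\<forall>\<omega>. ?Q \<omega> (blinfun_apply (orthogonal_projection T) \<omega>)"
    unfolding orthogonal_projection_def
  proof (rule theI[where a = "Blinfun p"])
    show "\<forall>\<omega>. ?Q \<omega> (blinfun_apply (Blinfun p) \<omega>)" using p P by simp
    show "S = Blinfun p" if "\<forall>\<omega>. ?Q \<omega> (blinfun_apply S \<omega>)" for S
      using that P eq by (intro blinfun_eqI) metis
  qed
  then show "blinfun_apply (orthogonal_projection T) \<omega> \<in> T"
    and "\<xi> \<in> T \<Longrightarrow> orthogonal (\<omega> - blinfun_apply (orthogonal_projection T) \<omega>) \<xi>"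
    by blast+
qed

definition positive_definite :: "('e::real_inner \<Rightarrow>\<^sub>L 'e) \<Rightarrow> bool"
  where "positive_definite g \<longleftrightarrow>
    (\<forall>\<omega> \<omega>'. blinfun_apply g \<omega> \<bullet> \<omega>' = \<omega> \<bullet> blinfun_apply g \<omega>') \<and>
    (\<forall>\<omega>. \<omega> \<noteq> 0 \<longrightarrow> \<omega> \<bullet> blinfun_apply g \<omega> > 0)"

definition represents_metric ::
    "('a, 'm::real_normed_vector) chart set \<Rightarrow> ('a \<Rightarrow> 'e::real_inner)
      \<Rightarrow> ('a \<Rightarrow> 'e \<Rightarrow> 'e \<Rightarrow> real) \<Rightarrow> 'a \<Rightarrow> ('e \<Rightarrow>\<^sub>L 'e) \<Rightarrow> bool"
  where "represents_metric A \<iota> R x G \<longleftrightarrow>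
    (\<forall>\<eta>\<in>tangent_space A \<iota> x. \<forall>\<xi>\<in>tangent_space A \<iota> x. R x \<eta> \<xi> = \<eta> \<bullet> blinfun_apply G \<xi>)"

(* h is a self-adjoint linear operator on the subspace T with b \<xi> \<eta> = \<xi> \<bullet> h \<eta> on T. Functions on
   T are made extensional, so that operators on T agreeing on T are equal. *)

definition metric_operator_on ::
    "'e::real_inner set \<Rightarrow> ('e \<Rightarrow> 'e \<Rightarrow> real) \<Rightarrow> ('e \<Rightarrow> 'e) \<Rightarrow> bool"
  where "metric_operator_on T b h \<longleftrightarrow>
    h \<in> T \<rightarrow>\<^sub>E T \<and>
    (\<forall>\<xi>\<in>T. \<forall>\<eta>\<in>T. \<forall>r s. h (r *\<^sub>R \<xi> + s *\<^sub>R \<eta>) = r *\<^sub>R h \<xi> + s *\<^sub>R h \<eta>) \<and>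
    (\<forall>\<xi>\<in>T. \<forall>\<eta>\<in>T. h \<xi> \<bullet> \<eta> = \<xi> \<bullet> h \<eta>) \<and>
    (\<forall>\<xi>\<in>T. \<forall>\<eta>\<in>T. b \<xi> \<eta> = \<xi> \<bullet> h \<eta>)"

definition metric_operator :: "'e::real_inner set \<Rightarrow> ('e \<Rightarrow> 'e \<Rightarrow> real) \<Rightarrow> 'e \<Rightarrow> 'e"
  where "metric_operator T b = (THE h. metric_operator_on T b h)"

end

theory Submission
  imports Defs
begin

text \<open>
  Fix a chart and write \<open>f\<^sub>b(u)\<close> for the image, under the derivative at \<open>u\<close> of the embedding read
  in the chart, of a basis vector \<open>b\<close> of the model space. The \<open>f\<^sub>b(u)\<close> depend smoothly on \<open>u\<close> and
  form a basis of the tangent space, by injectivity of the derivative together with the chain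
  rule, which shows that no other chart contributes further vectors
  (\<open>tangent_space_chart\<close>). The claim therefore concerns a smoothly varying subspace with a smooth
  basis.

  Everything is read off from the dual basis \<open>c\<^sub>b(u)\<close>: the vectors of the same tangent space with
  \<open>c\<^sub>a \<bullet> f\<^sub>b = \<delta>\<^sub>a\<^sub>b\<close>. The projection sends \<open>\<omega>\<close> to \<open>\<Sum>\<^sub>b (\<omega> \<bullet> c\<^sub>b) f\<^sub>b\<close>, and the metric operator
  composed with it sends \<open>\<omega>\<close> to \<open>\<Sum>\<^sub>a\<^sub>b R(f\<^sub>a, f\<^sub>b) (\<omega> \<bullet> c\<^sub>b) c\<^sub>a\<close>
  (\<open>orthogonal_projection_dual_family\<close>, \<open>metric_operator_on_dual_family\<close>). Both are sums of products
  of smooth functions once the \<open>c\<^sub>b\<close> are smooth. That is \<open>smooth_dual_family_exists\<close>: the dual basis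
  is built up one vector at a time as in the Gram-Schmidt process, and the only division is by
  the squared length of a vector that independence keeps away from zero. No Gram matrix has to be
  inverted.

  Positivity of \<open>g\<close> is pointwise. Splitting \<open>\<omega>\<close> into its tangential part \<open>P\<omega>\<close> and its normal part
  gives \<open>\<omega> \<bullet> g\<omega> = |\<omega> - P\<omega>|\<^sup>2 + R(P\<omega>, P\<omega>)\<close>, and the two terms vanish together only at \<open>\<omega> = 0\<close>
  (\<open>metric_extension_positive_definite\<close>).
\<close>

section \<open>Calculus of smooth maps\<close>

text \<open>The derivatives in \<open>Ck_on\<close> are taken in the whole space. They are determined by the values on
  \<open>S\<close> because \<open>S\<close> is open.\<close>

lemma Ck_on_cong:
  assumes S: "open S" and eq: "\<And>u. u \<in> S \<Longrightarrow> f u = g u" and f: "Ck_on k S f"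
  shows "Ck_on k S g"
  using eq f
proof (induction k arbitrary: f g)
  case 0
  then show ?case using continuous_on_cong by force
next
  case (Suc k)
  have D: "(g has_derivative frechet_derivative f (at u)) (at u)" if "u \<in> S" for u
  proof (rule has_derivative_transform_within_open[OF _ S that])
    show "(f has_derivative frechet_derivative f (at u)) (at u)"
      using Suc.prems(2) that by (simp add: frechet_derivative_works)
  qed (use Suc.prems(1) in auto)
  have "Ck_on k S (\<lambda>u. frechet_derivative g (at u) v)" for v
  proof (rule Suc.IH)
    show "frechet_derivative f (at u) v = frechet_derivative g (at u) v" if "u \<in> S" for u
      using frechet_derivative_at[OF D[OF that]] by simp
    show "Ck_on k S (\<lambda>u. frechet_derivative f (at u) v)" using Suc.prems(2) by simp
  qed
  moreover have "\<forall>u\<in>S. g differentiable (at u)"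
    using D differentiable_def by blast
  ultimately show ?case by simp
qed

text \<open>This replaces \<open>frechet_derivative\<close> by whatever formula the differentiation rules produce, and is
  what lets the closure properties below be proved by induction on the order.\<close>

lemma Ck_on_SucI:
  assumes "open S" and "\<And>u. u \<in> S \<Longrightarrow> (f has_derivative f' u) (at u)"
    and "\<And>v. Ck_on k S (\<lambda>u. f' u v)"
  shows "Ck_on (Suc k) S f"
proof -
  have "frechet_derivative f (at u) = f' u" if "u \<in> S" for u
    using frechet_derivative_at[OF assms(2)[OF that]] by simp
  then have "Ck_on k S (\<lambda>u. frechet_derivative f (at u) v)" for v
    using Ck_on_cong[OF assms(1) _ assms(3)[of v]] by simp
  then show ?thesis using differentiableI[OF assms(2)] by simp
qed

lemma Ck_on_Suc_has_derivative:
  "Ck_on (Suc k) S f \<Longrightarrow> u \<in> S \<Longrightarrow> (f has_derivative frechet_derivative f (at u)) (at u)"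
  by (simp add: frechet_derivative_works)

lemma Ck_on_Suc_imp: "Ck_on (Suc k) S f \<Longrightarrow> Ck_on k S f"
proof (induction k arbitrary: f)
  case 0
  then show ?case
    by (auto intro!: continuous_at_imp_continuous_on differentiable_imp_continuous_within)
next
  case (Suc k)
  then show ?case by (metis Ck_on.simps(2))
qed

lemma Ck_on_const: "open S \<Longrightarrow> Ck_on k S (\<lambda>_. a)"
proof (induction k arbitrary: a)
  case (Suc k)
  then show ?case by (intro Ck_on_SucI[where f' = "\<lambda>_ _. 0"]) auto
qed simp

lemma Ck_on_add:
  assumes "open S" "Ck_on k S f" "Ck_on k S g"
  shows "Ck_on k S (\<lambda>u. f u + g u)"
  using assms(2,3)
proof (induction k arbitrary: f g)
  case 0
  then show ?case by (simp add: continuous_on_add)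
next
  case (Suc k)
  show ?case
    by (rule Ck_on_SucI[OF assms(1)
          has_derivative_add[OF Ck_on_Suc_has_derivative[OF Suc.prems(1)]
            Ck_on_Suc_has_derivative[OF Suc.prems(2)]]])
       (use Suc in auto)
qed

lemma Ck_on_bilinear:
  assumes "bounded_bilinear m" "open S" "Ck_on k S f" "Ck_on k S g"
  shows "Ck_on k S (\<lambda>u. m (f u) (g u))"
  using assms(3,4)
proof (induction k arbitrary: f g)
  case 0
  then show ?case by (simp add: bounded_bilinear.continuous_on[OF assms(1)])
next
  case (Suc k)
  have "Ck_on k S f" "Ck_on k S g"
    using Suc.prems Ck_on_Suc_imp by blast+
  \<comment> \<open>By the product rule the derivative is a sum of two products, each pairing a derivative with
    one of the original factors; the latter are also of class \<open>C\<^sup>k\<close>.\<close>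
  with Suc show ?case
    by (intro Ck_on_SucI[OF assms(2)
          bounded_bilinear.FDERIV[OF assms(1) Ck_on_Suc_has_derivative[OF Suc.prems(1)]
            Ck_on_Suc_has_derivative[OF Suc.prems(2)]]] Ck_on_add[OF assms(2)])
       auto
qed

text \<open>The derivative of \<open>1/f\<close> is built from \<open>f'\<close> and \<open>1/f\<close> itself by products, so each order of
  differentiability of \<open>1/f\<close> follows from the order below.\<close>

lemma Ck_on_inverse:
  fixes f :: "'m::real_normed_vector \<Rightarrow> real"
  assumes "open S" "\<And>u. u \<in> S \<Longrightarrow> f u \<noteq> 0" "Ck_on k S f"
  shows "Ck_on k S (\<lambda>u. inverse (f u))"
  using assms(3)
proof (induction k)
  case 0
  then show ?case using assms(2) by (simp add: continuous_on_inverse)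
next
  case (Suc k)
  have inv: "Ck_on k S (\<lambda>u. inverse (f u))"
    using Suc Ck_on_Suc_imp by blast
  have D: "Ck_on k S (\<lambda>u. frechet_derivative f (at u) v)" for v
    using Suc.prems by simp
  note mult = Ck_on_bilinear[OF bounded_bilinear_mult assms(1)]
  have "Ck_on k S (\<lambda>u. (- 1) * (inverse (f u) * frechet_derivative f (at u) v * inverse (f u)))" for v
    by (rule mult[OF Ck_on_const[OF assms(1)] mult[OF mult[OF inv D] inv]])
  then show ?case
    by (intro Ck_on_SucI[OF assms(1)
          Deriv.has_derivative_inverse[OF assms(2) Ck_on_Suc_has_derivative[OF Suc.prems]]])
       auto
qed

lemma smooth_on_cong:
  "open S \<Longrightarrow> (\<And>u. u \<in> S \<Longrightarrow> f u = g u) \<Longrightarrow> smooth_on S f \<Longrightarrow> smooth_on S g"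
  unfolding smooth_on_def by (metis Ck_on_cong)

lemma smooth_on_has_derivative:
  "smooth_on S f \<Longrightarrow> u \<in> S \<Longrightarrow> (f has_derivative frechet_derivative f (at u)) (at u)"
  unfolding smooth_on_def by (metis Ck_on_Suc_has_derivative)

lemma smooth_on_derivative:
  "smooth_on S f \<Longrightarrow> smooth_on S (\<lambda>u. frechet_derivative f (at u) v)"
  unfolding smooth_on_def by (metis Ck_on.simps(2))

lemma smooth_on_const: "open S \<Longrightarrow> smooth_on S (\<lambda>_. a)"
  by (simp add: smooth_on_def Ck_on_const)

lemma smooth_on_add:
  "open S \<Longrightarrow> smooth_on S f \<Longrightarrow> smooth_on S g \<Longrightarrow> smooth_on S (\<lambda>u. f u + g u)"
  by (simp add: smooth_on_def Ck_on_add)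

lemma smooth_on_bilinear:
  "bounded_bilinear m \<Longrightarrow> open S \<Longrightarrow> smooth_on S f \<Longrightarrow> smooth_on S g
    \<Longrightarrow> smooth_on S (\<lambda>u. m (f u) (g u))"
  by (simp add: smooth_on_def Ck_on_bilinear)

lemmas smooth_on_scaleR = smooth_on_bilinear[OF bounded_bilinear_scaleR]
lemmas smooth_on_inner = smooth_on_bilinear[OF bounded_bilinear_inner]

lemma smooth_on_inverse:
  fixes f :: "'m::real_normed_vector \<Rightarrow> real"
  shows "open S \<Longrightarrow> (\<And>u. u \<in> S \<Longrightarrow> f u \<noteq> 0) \<Longrightarrow> smooth_on S f
    \<Longrightarrow> smooth_on S (\<lambda>u. inverse (f u))"
  by (simp add: smooth_on_def Ck_on_inverse)

lemma smooth_on_diff: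
  assumes "open S" "smooth_on S f" "smooth_on S g"
  shows "smooth_on S (\<lambda>u. f u - g u)"
  using smooth_on_add[OF assms(1,2)
      smooth_on_scaleR[OF assms(1) smooth_on_const[OF assms(1), of "- 1"] assms(3)]]
  by simp

lemma smooth_on_sum:
  assumes "open S" "\<And>i. i \<in> I \<Longrightarrow> smooth_on S (f i)"
  shows "smooth_on S (\<lambda>u. \<Sum>i\<in>I. f i u)"
  using assms(2)
proof (induction I rule: infinite_finite_induct)
  case (insert i I)
  then show ?case by (simp add: smooth_on_add[OF assms(1)])
qed (simp_all add: smooth_on_const[OF assms(1)])


section \<open>Dual families\<close>

text \<open>Requiring the \<open>c a\<close> to lie in the span of the \<open>f b\<close> makes the dual vectors unique and, more
  to the point, makes them blind to the component of a vector orthogonal to that span.\<close>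

definition dual_family :: "'i set \<Rightarrow> ('i \<Rightarrow> 'e::real_inner) \<Rightarrow> ('i \<Rightarrow> 'e) \<Rightarrow> bool"
  where "dual_family B f c \<longleftrightarrow>
    (\<forall>a\<in>B. c a \<in> span (f ` B)) \<and> (\<forall>a\<in>B. \<forall>b\<in>B. c a \<bullet> f b = of_bool (a = b))"

lemma dual_family_sum:
  assumes "finite B" "dual_family B f c" "a \<in> B"
  shows "c a \<bullet> (\<Sum>b\<in>B. r b *\<^sub>R f b) = r a" and "(\<Sum>b\<in>B. r b *\<^sub>R c b) \<bullet> f a = r a"
proof -
  have "c a \<bullet> (\<Sum>b\<in>B. r b *\<^sub>R f b) = (\<Sum>b\<in>B. if a = b then r b else 0)"
    using assms unfolding inner_sum_right dual_family_def by (intro sum.cong) auto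
  then show "c a \<bullet> (\<Sum>b\<in>B. r b *\<^sub>R f b) = r a" using assms by simp
  have "(\<Sum>b\<in>B. r b *\<^sub>R c b) \<bullet> f a = (\<Sum>b\<in>B. if a = b then r b else 0)"
    using assms unfolding inner_sum_left dual_family_def by (intro sum.cong) auto
  then show "(\<Sum>b\<in>B. r b *\<^sub>R c b) \<bullet> f a = r a" using assms by simp
qed

lemma orthogonal_span_image:
  assumes "\<And>a. a \<in> B \<Longrightarrow> x \<bullet> f a = 0" "v \<in> span (f ` B)"
  shows "x \<bullet> v = 0"
  using orthogonal_to_span[of v "f ` B" x] assms by (auto simp: orthogonal_def)

text \<open>The difference of the two sides is orthogonal to every \<open>f a\<close> and lies in their span, so it
  is orthogonal to itself. In particular the \<open>c b\<close> span the same space as the \<open>f b\<close>.\<close>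

lemma dual_family_expand:
  assumes "finite B" "dual_family B f c" "v \<in> span (f ` B)"
  shows "v = (\<Sum>b\<in>B. (v \<bullet> f b) *\<^sub>R c b)"
proof -
  let ?x = "v - (\<Sum>b\<in>B. (v \<bullet> f b) *\<^sub>R c b)"
  have "?x \<in> span (f ` B)"
    using assms by (intro span_diff span_sum span_scale) (auto simp: dual_family_def)
  moreover have "?x \<bullet> f a = 0" if "a \<in> B" for a
    using dual_family_sum(2)[OF assms(1,2) that] by (simp add: inner_diff_left)
  ultimately have "?x \<bullet> ?x = 0" by (metis orthogonal_span_image)
  then show ?thesis by simp
qed

text \<open>By duality the residual is orthogonal to every \<open>c a\<close>, and these span the same space as the
  \<open>f a\<close>. Hence the sum is the orthogonal projection of \<open>\<omega>\<close>.\<close>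

lemma dual_family_residual_orthogonal:
  assumes "finite B" "dual_family B f c" "v \<in> span (f ` B)"
  shows "(\<omega> - (\<Sum>b\<in>B. (\<omega> \<bullet> c b) *\<^sub>R f b)) \<bullet> v = 0"
proof -
  let ?x = "\<omega> - (\<Sum>b\<in>B. (\<omega> \<bullet> c b) *\<^sub>R f b)"
  have "?x \<bullet> c a = 0" if "a \<in> B" for a
    using dual_family_sum(1)[OF assms(1,2) that, of "\<lambda>b. \<omega> \<bullet> c b"]
    by (simp add: inner_commute[of _ "c a"] inner_diff_right)
  then have "?x \<bullet> (\<Sum>b\<in>B. (v \<bullet> f b) *\<^sub>R c b) = 0" by (simp add: inner_sum_right)
  then show ?thesis using dual_family_expand[OF assms] by metis
qed

text \<open>One Gram-Schmidt step. The part \<open>q\<close> of the new vector orthogonal to the old ones satisfies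
  \<open>q \<bullet> f n = q \<bullet> q\<close>, so \<open>q\<close> divided by this number is the new dual vector. Subtracting multiples of it
  makes the old dual vectors orthogonal to \<open>f n\<close> and does not change their products with the old
  \<open>f b\<close>. All formulas are rational in the data, so smooth dependence on a parameter is inherited.\<close>

lemma dual_family_insert:
  assumes B: "finite B" "n \<notin> B" and dual: "dual_family B f c" and n: "f n \<notin> span (f ` B)"
  defines "q \<equiv> f n - (\<Sum>b\<in>B. (f n \<bullet> c b) *\<^sub>R f b)"
  defines "d \<equiv> inverse (q \<bullet> q) *\<^sub>R q"
  shows "q \<bullet> q \<noteq> 0"
    and "dual_family (insert n B) f (\<lambda>b. if b = n then d else c b - (c b \<bullet> f n) *\<^sub>R d)"
proof -
  have s: "(\<Sum>b\<in>B. (f n \<bullet> c b) *\<^sub>R f b) \<in> span (f ` B)"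
    by (intro span_sum span_scale span_base) auto
  then show nz: "q \<bullet> q \<noteq> 0" using n by (auto simp: q_def)
  have q: "q \<bullet> v = 0" if "v \<in> span (f ` B)" for v
    unfolding q_def by (rule dual_family_residual_orthogonal[OF B(1) dual that])
  have "q \<bullet> f n = q \<bullet> (q + (\<Sum>b\<in>B. (f n \<bullet> c b) *\<^sub>R f b))" by (simp add: q_def)
  also have "\<dots> = q \<bullet> q" using q[OF s] by (simp add: inner_add_right)
  finally have dn: "d \<bullet> f n = 1" using nz by (simp add: d_def)
  have db: "d \<bullet> f b = 0" if "b \<in> B" for b
    using q[OF span_base] that by (simp add: d_def)
  have mono: "span (f ` B) \<subseteq> span (f ` insert n B)" by (intro span_mono) auto
  have "q \<in> span (f ` insert n B)"
    unfolding q_def using s mono by (intro span_diff) (auto intro: span_base)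
  then have d: "d \<in> span (f ` insert n B)" unfolding d_def by (rule span_scale)
  have c: "c a \<in> span (f ` insert n B)" "b \<in> B \<Longrightarrow> c a \<bullet> f b = of_bool (a = b)"
    if "a \<in> B" for a b
    using dual that mono unfolding dual_family_def by blast+
  show "dual_family (insert n B) f (\<lambda>b. if b = n then d else c b - (c b \<bullet> f n) *\<^sub>R d)"
    unfolding dual_family_def
  proof (intro conjI ballI)
    fix a assume a: "a \<in> insert n B"
    show "(if a = n then d else c a - (c a \<bullet> f n) *\<^sub>R d) \<in> span (f ` insert n B)"
      using a d c(1) by (auto intro: span_diff span_scale)
    fix b assume b: "b \<in> insert n B"
    show "(if a = n then d else c a - (c a \<bullet> f n) *\<^sub>R d) \<bullet> f b = of_bool (a = b)"
      using a b B(2) dn db c(2) by (auto simp: inner_diff_left)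
  qed
qed

lemma smooth_dual_family_exists:
  fixes f :: "'i \<Rightarrow> 'm::real_normed_vector \<Rightarrow> 'e::real_inner"
  assumes S: "open S" and "finite B" "\<And>b. b \<in> B \<Longrightarrow> smooth_on S (f b)"
    and "\<And>u. u \<in> S \<Longrightarrow> inj_on (\<lambda>b. f b u) B"
    and "\<And>u. u \<in> S \<Longrightarrow> independent ((\<lambda>b. f b u) ` B)"
  shows "\<exists>c. (\<forall>b\<in>B. smooth_on S (c b)) \<and>
    (\<forall>u\<in>S. dual_family B (\<lambda>b. f b u) (\<lambda>b. c b u))"
  using assms(2-)
proof (induction B rule: finite_induct)
  case empty
  then show ?case by (simp add: dual_family_def)
next
  case (insert n B)
  have "independent ((\<lambda>b. f b u) ` B)" if "u \<in> S" for u
    by (rule independent_mono[OF insert.prems(3)[OF that]]) auto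
  moreover have "inj_on (\<lambda>b. f b u) B" if "u \<in> S" for u
    using insert.prems(2)[OF that] by simp
  moreover have "smooth_on S (f b)" if "b \<in> B" for b
    using insert.prems(1) that by blast
  ultimately have "\<exists>c. (\<forall>b\<in>B. smooth_on S (c b)) \<and>
      (\<forall>u\<in>S. dual_family B (\<lambda>b. f b u) (\<lambda>b. c b u))"
    using insert.IH by blast
  then obtain c where c: "\<And>b. b \<in> B \<Longrightarrow> smooth_on S (c b)"
      "\<And>u. u \<in> S \<Longrightarrow> dual_family B (\<lambda>b. f b u) (\<lambda>b. c b u)"
    by blast
  have n: "f n u \<notin> span ((\<lambda>b. f b u) ` B)" if "u \<in> S" for u
    using insert.prems(2,3)[OF that] insert.hyps(2) by (auto simp: independent_insert)
  define q where "q u = f n u - (\<Sum>b\<in>B. (f n u \<bullet> c b u) *\<^sub>R f b u)" for u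
  define d where "d u = inverse (q u \<bullet> q u) *\<^sub>R q u" for u
  note step = dual_family_insert[OF insert.hyps(1,2) c(2) n, folded q_def, folded d_def]
  have fs: "smooth_on S (f b)" if "b \<in> insert n B" for b
    using insert.prems(1) that by blast
  have q: "smooth_on S q"
    unfolding q_def using fs c(1) S
    by (intro smooth_on_diff smooth_on_sum smooth_on_scaleR smooth_on_inner) auto
  have d: "smooth_on S d"
    unfolding d_def using S step(1) q
    by (intro smooth_on_scaleR smooth_on_inverse smooth_on_inner) auto
  show ?case
  proof (intro exI[of _ "\<lambda>b u. if b = n then d u else c b u - (c b u \<bullet> f n u) *\<^sub>R d u"] conjI ballI)
    fix b assume "b \<in> insert n B"
    then show "smooth_on S (\<lambda>u. if b = n then d u else c b u - (c b u \<bullet> f n u) *\<^sub>R d u)"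
      using S d c(1) fs
      by (cases "b = n") (auto intro!: smooth_on_diff smooth_on_scaleR smooth_on_inner)
  next
    fix u assume "u \<in> S"
    then show "dual_family (insert n B) (\<lambda>b. f b u)
        (\<lambda>b. if b = n then d u else c b u - (c b u \<bullet> f n u) *\<^sub>R d u)"
      using step(2) by blast
  qed
qed


section \<open>Operators given by a dual family\<close>

text \<open>Operators are assembled from \<open>rank_one\<close> because it is bilinear as a map into the normed space
  of operators: smoothness of operator-valued maps then follows from the product rule, without
  passing to matrix entries.\<close>

definition rank_one :: "'e::real_inner \<Rightarrow> 'e \<Rightarrow> 'e \<Rightarrow>\<^sub>L 'e"
  where "rank_one y z = blinfun_scaleR_left y o\<^sub>L blinfun_inner_left z"

lemma rank_one_apply [simp]: "blinfun_apply (rank_one y z) \<omega> = (\<omega> \<bullet> z) *\<^sub>R y"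
  by (simp add: rank_one_def)

lemma bounded_bilinear_rank_one: "bounded_bilinear rank_one"
  unfolding rank_one_def
  by (rule bounded_bilinear.comp[OF bounded_bilinear_blinfun_compose
        bounded_linear_blinfun_scaleR_left bounded_linear_blinfun_inner_left])

lemmas smooth_on_rank_one = smooth_on_bilinear[OF bounded_bilinear_rank_one]

lemma orthogonal_projection_dual_family:
  fixes f :: "'i \<Rightarrow> 'e::euclidean_space"
  assumes "finite B" "dual_family B f c"
  shows "orthogonal_projection (span (f ` B)) = (\<Sum>b\<in>B. rank_one (f b) (c b))"
proof (rule blinfun_eqI)
  fix \<omega>
  let ?T = "span (f ` B)"
  have "(\<Sum>b\<in>B. (\<omega> \<bullet> c b) *\<^sub>R f b) \<in> ?T"
    by (intro span_sum span_scale span_base) auto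
  then show "blinfun_apply (orthogonal_projection ?T) \<omega> = blinfun_apply (\<Sum>b\<in>B. rank_one (f b) (c b)) \<omega>"
    using orthogonal_projection_unique[of ?T _ _ \<omega>] orthogonal_projection_props[of ?T]
      dual_family_residual_orthogonal[OF assms]
    by (simp add: blinfun.sum_left orthogonal_def)
qed

lemmas inner_product_on_linear =
  inner_product_on_def[THEN iffD1, THEN conjunct1, THEN bspec, THEN bspec, THEN bspec,
    THEN spec, THEN spec]

lemmas inner_product_on_commute =
  inner_product_on_def[THEN iffD1, THEN conjunct2, THEN conjunct1, THEN bspec, THEN bspec]

lemmas inner_product_on_pos =
  inner_product_on_def[THEN iffD1, THEN conjunct2, THEN conjunct2, THEN bspec, THEN mp]

lemma inner_product_on_sum_right:
  assumes T: "subspace T" and b: "inner_product_on T \<beta>"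
    and "finite I" "\<And>i. i \<in> I \<Longrightarrow> f i \<in> T" "x \<in> T"
  shows "\<beta> x (\<Sum>i\<in>I. r i *\<^sub>R f i) = (\<Sum>i\<in>I. r i * \<beta> x (f i))"
  using assms(3,4)
proof (induction I rule: finite_induct)
  case empty
  show ?case
    using inner_product_on_linear[OF b assms(5,5,5), of 0 0]
      inner_product_on_commute[OF b assms(5) subspace_0[OF T]] by simp
next
  case (insert i I)
  let ?y = "\<Sum>i\<in>I. r i *\<^sub>R f i"
  have y: "?y \<in> T" and fi: "f i \<in> T" and s: "r i *\<^sub>R f i + 1 *\<^sub>R ?y \<in> T"
    using T insert.prems by (auto intro!: subspace_sum subspace_scale subspace_add)
  have "\<beta> x (r i *\<^sub>R f i + 1 *\<^sub>R ?y) = \<beta> (r i *\<^sub>R f i + 1 *\<^sub>R ?y) x"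
    by (rule inner_product_on_commute[OF b assms(5) s])
  also have "\<dots> = r i * \<beta> (f i) x + 1 * \<beta> ?y x"
    by (rule inner_product_on_linear[OF b fi y assms(5)])
  also have "\<dots> = r i * \<beta> x (f i) + 1 * \<beta> x ?y"
    using inner_product_on_commute[OF b _ assms(5)] y fi by simp
  finally show ?case using insert by simp
qed

lemmas metric_operator_on_PiE = metric_operator_on_def[THEN iffD1, THEN conjunct1]

lemmas metric_operator_on_represents =
  metric_operator_on_def[THEN iffD1, THEN conjunct2, THEN conjunct2, THEN conjunct2,
    THEN bspec, THEN bspec]

text \<open>For \<open>\<eta> \<in> T\<close> the vector \<open>h \<eta> - h' \<eta>\<close> lies in \<open>T\<close> and is orthogonal to \<open>T\<close>; outside \<open>T\<close> the two
  operators agree by extensionality.\<close>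

lemma metric_operator_on_unique:
  assumes T: "subspace T" and h: "metric_operator_on T \<beta> h" "metric_operator_on T \<beta> h'"
  shows "h = h'"
proof (rule PiE_ext[OF h[THEN metric_operator_on_PiE]])
  fix \<eta> assume \<eta>: "\<eta> \<in> T"
  have "\<xi> \<bullet> (h \<eta> - h' \<eta>) = 0" if "\<xi> \<in> T" for \<xi>
    using h[THEN metric_operator_on_represents, OF that \<eta>] by (simp add: inner_diff_right)
  moreover have "h \<eta> - h' \<eta> \<in> T"
    using subspace_diff[OF T] PiE_mem[OF metric_operator_on_PiE[OF h(1)] \<eta>]
      PiE_mem[OF metric_operator_on_PiE[OF h(2)] \<eta>] by blast
  ultimately show "h \<eta> = h' \<eta>" by (metis inner_eq_zero_iff right_minus_eq)
qed

lemma metric_operator_eq: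
  assumes "subspace T" "metric_operator_on T \<beta> h"
  shows "metric_operator T \<beta> = h"
  unfolding metric_operator_def
  using assms metric_operator_on_unique by (intro the_equality) auto

text \<open>Pairing \<open>M \<eta>\<close> with \<open>f a\<close> leaves \<open>\<Sum>\<^sub>b \<beta> (f a) (f b) (\<eta> \<bullet> c b)\<close>, which is \<open>\<beta> (f a) \<eta>\<close> because the
  \<open>\<eta> \<bullet> c b\<close> are the coordinates of \<open>\<eta>\<close> in the basis \<open>f\<close>. So \<open>M\<close> represents \<open>\<beta>\<close>, and it is
  self-adjoint because \<open>\<beta>\<close> is symmetric.\<close>

lemma metric_operator_on_dual_family:
  fixes f :: "'i \<Rightarrow> 'e::real_inner"
  assumes B: "finite B" and dual: "dual_family B f c"
    and \<beta>: "inner_product_on (span (f ` B)) \<beta>"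
  defines "M \<equiv> \<Sum>a\<in>B. \<Sum>b\<in>B. \<beta> (f a) (f b) *\<^sub>R rank_one (c a) (c b)"
  shows "metric_operator_on (span (f ` B)) \<beta> (restrict (blinfun_apply M) (span (f ` B)))"
proof -
  let ?T = "span (f ` B)"
  have f: "f b \<in> ?T" if "b \<in> B" for b using that by (auto intro: span_base)
  have sym: "\<beta> x y = \<beta> y x" if "x \<in> ?T" "y \<in> ?T" for x y
    using inner_product_on_commute[OF \<beta> that] .
  have M: "blinfun_apply M \<omega> = (\<Sum>a\<in>B. (\<Sum>b\<in>B. (\<omega> \<bullet> c b) * \<beta> (f a) (f b)) *\<^sub>R c a)" for \<omega>
    by (simp add: M_def blinfun.sum_left blinfun.scaleR_left scaleR_sum_left mult.commute)
  have MT: "blinfun_apply M \<omega> \<in> ?T" for \<omega>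
    using dual unfolding M dual_family_def by (intro span_sum span_scale) auto
  have expand: "\<eta> = (\<Sum>b\<in>B. (\<eta> \<bullet> c b) *\<^sub>R f b)" if "\<eta> \<in> ?T" for \<eta>
  proof -
    let ?x = "\<eta> - (\<Sum>b\<in>B. (\<eta> \<bullet> c b) *\<^sub>R f b)"
    have "?x \<in> ?T" using that f by (intro span_diff span_sum span_scale) auto
    then have "?x \<bullet> ?x = 0" by (rule dual_family_residual_orthogonal[OF B dual])
    then show ?thesis by simp
  qed
  have \<beta>f: "f a \<bullet> blinfun_apply M \<eta> = \<beta> (f a) \<eta>" if "a \<in> B" "\<eta> \<in> ?T" for a \<eta>
  proof -
    have "f a \<bullet> blinfun_apply M \<eta> = (\<Sum>b\<in>B. (\<eta> \<bullet> c b) * \<beta> (f a) (f b))"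
      unfolding M using dual_family_sum(2)[OF B dual that(1)] by (simp add: inner_commute)
    also have "\<dots> = \<beta> (f a) (\<Sum>b\<in>B. (\<eta> \<bullet> c b) *\<^sub>R f b)"
      using inner_product_on_sum_right[OF subspace_span \<beta> B, of f "f a"] f that by simp
    finally show ?thesis using expand[OF that(2), symmetric] by simp
  qed
  have rep: "\<beta> \<xi> \<eta> = \<xi> \<bullet> blinfun_apply M \<eta>" if "\<xi> \<in> ?T" "\<eta> \<in> ?T" for \<xi> \<eta>
  proof -
    have "\<beta> \<xi> \<eta> = \<beta> \<eta> (\<Sum>b\<in>B. (\<xi> \<bullet> c b) *\<^sub>R f b)"
      using sym[OF that] expand[OF that(1), symmetric] by simp
    also have "\<dots> = (\<Sum>b\<in>B. (\<xi> \<bullet> c b) * \<beta> \<eta> (f b))"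
      using inner_product_on_sum_right[OF subspace_span \<beta> B, of f \<eta>] f that by simp
    also have "\<dots> = (\<Sum>b\<in>B. (\<xi> \<bullet> c b) *\<^sub>R f b) \<bullet> blinfun_apply M \<eta>"
      using \<beta>f sym f that by (simp add: inner_sum_left)
    finally show ?thesis using expand[OF that(1), symmetric] by simp
  qed
  have sa: "blinfun_apply M \<xi> \<bullet> \<eta> = \<xi> \<bullet> blinfun_apply M \<eta>" if "\<xi> \<in> ?T" "\<eta> \<in> ?T" for \<xi> \<eta>
    using rep[OF that] rep[OF that(2,1)] sym[OF that] by (simp add: inner_commute)
  show ?thesis
    unfolding metric_operator_on_def
  proof (intro conjI ballI allI)
    show "restrict (blinfun_apply M) ?T \<in> ?T \<rightarrow>\<^sub>E ?T" using MT by simp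
  qed (use rep sa in \<open>simp_all add: blinfun.add_right blinfun.scaleR_right span_add span_scale\<close>)
qed

lemma orthogonal_projection_inner:
  fixes T :: "'e::euclidean_space set"
  assumes "subspace T" "\<xi> \<in> T"
  shows "\<omega> \<bullet> \<xi> = blinfun_apply (orthogonal_projection T) \<omega> \<bullet> \<xi>"
  using orthogonal_projection_props(2)[OF assms, of \<omega>] by (simp add: orthogonal_def inner_diff_left)

text \<open>Everything follows from one identity for the bilinear form of \<open>G\<close>, the fact \<open>form\<close> in the
  proof: the form of \<open>G\<close> is the orthogonal sum of the ambient inner product on the normal space and
  \<open>\<beta>\<close> on \<open>T\<close>.\<close>

lemma metric_extension_positive_definite:
  fixes T :: "'e::euclidean_space set"
  assumes T: "subspace T" and \<beta>: "inner_product_on T \<beta>" and h: "metric_operator_on T \<beta> h"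
    and G: "\<And>\<omega>. blinfun_apply G \<omega> = (id_blinfun - orthogonal_projection T) \<omega>
      + h (orthogonal_projection T \<omega>)"
  shows "positive_definite G"
    and "\<And>\<eta> \<xi>. \<eta> \<in> T \<Longrightarrow> \<xi> \<in> T \<Longrightarrow> \<beta> \<eta> \<xi> = \<eta> \<bullet> blinfun_apply G \<xi>"
proof -
  let ?P = "blinfun_apply (orthogonal_projection T)"
  note PT = orthogonal_projection_props(1)[OF T]
  note Pin = orthogonal_projection_inner[OF T]
  have hT: "h \<xi> \<in> T" if "\<xi> \<in> T" for \<xi>
    by (rule PiE_mem[OF metric_operator_on_PiE[OF h] that])
  have form: "\<omega> \<bullet> blinfun_apply G \<omega>' = (\<omega> - ?P \<omega>) \<bullet> (\<omega>' - ?P \<omega>') + \<beta> (?P \<omega>) (?P \<omega>')" for \<omega> \<omega>'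
  proof -
    have "?P \<omega> \<bullet> (\<omega>' - ?P \<omega>') = 0"
      using Pin[OF PT, of \<omega>' \<omega>] by (simp add: inner_diff_right inner_commute)
    moreover have "\<beta> (?P \<omega>) (?P \<omega>') = ?P \<omega> \<bullet> h (?P \<omega>')"
      by (rule metric_operator_on_represents[OF h PT PT])
    then have "\<omega> \<bullet> h (?P \<omega>') = \<beta> (?P \<omega>) (?P \<omega>')"
      using Pin[OF hT[OF PT], of \<omega> \<omega>'] by simp
    ultimately show ?thesis
      by (simp add: G inner_add_right blinfun.diff_left inner_diff_left)
  qed
  have sym: "\<beta> (?P \<omega>) (?P \<omega>') = \<beta> (?P \<omega>') (?P \<omega>)" for \<omega> \<omega>'
    by (rule inner_product_on_commute[OF \<beta> PT PT])
  have nonneg: "\<beta> \<xi> \<xi> \<ge> 0" if "\<xi> \<in> T" for \<xi>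
  proof (cases "\<xi> = 0")
    case True
    then show ?thesis using inner_product_on_linear[OF \<beta> that that that, of 0 0] by simp
  next
    case False
    then show ?thesis using inner_product_on_pos[OF \<beta> that] by simp
  qed
  have "\<omega> \<bullet> blinfun_apply G \<omega> > 0" if "\<omega> \<noteq> 0" for \<omega>
  proof (cases "?P \<omega> = 0")
    case True
    then show ?thesis using form[of \<omega> \<omega>] nonneg[OF PT, of \<omega>] that
      by (simp add: add_pos_nonneg)
  next
    case False
    then have "\<beta> (?P \<omega>) (?P \<omega>) > 0" by (rule inner_product_on_pos[OF \<beta> PT])
    then show ?thesis using form[of \<omega> \<omega>] by (simp add: add_nonneg_pos)
  qed
  moreover have "blinfun_apply G \<omega> \<bullet> \<omega>' = \<omega> \<bullet> blinfun_apply G \<omega>'" for \<omega> \<omega>'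
    using form[of \<omega> \<omega>'] form[of \<omega>' \<omega>] sym[of \<omega> \<omega>'] by (simp add: inner_commute)
  ultimately show "positive_definite G" by (simp add: positive_definite_def)
  show "\<beta> \<eta> \<xi> = \<eta> \<bullet> blinfun_apply G \<xi>" if "\<eta> \<in> T" "\<xi> \<in> T" for \<eta> \<xi>
  proof -
    have "?P \<zeta> = \<zeta>" if "\<zeta> \<in> T" for \<zeta>
      using orthogonal_projection_unique[OF T, of "?P \<zeta>" \<zeta> \<zeta>] that
        orthogonal_projection_props[OF T] by (simp add: orthogonal_def)
    then show ?thesis using form that by simp
  qed
qed


section \<open>Tangent spaces in charts\<close>

abbreviation chart_derivative ::
    "('a \<Rightarrow> 'e::real_normed_vector) \<Rightarrow> 'a set \<Rightarrow> ('a \<Rightarrow> 'm::real_normed_vector) \<Rightarrow> 'm \<Rightarrow> 'm \<Rightarrow> 'e"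
  where "chart_derivative \<iota> U \<phi> u \<equiv> frechet_derivative (\<iota> \<circ> inv_into U \<phi>) (at u)"

lemma is_chart_inj_on:
  assumes "is_chart X (U, \<phi>)"
  shows "inj_on \<phi> U"
proof -
  have "openin X U" "homeomorphic_map (subtopology X U) (top_of_set (\<phi> ` U)) \<phi>"
    using assms unfolding is_chart_def by auto
  then show ?thesis
    using homeomorphic_imp_injective_map openin_subset topspace_subtopology_subset by metis
qed

lemma is_chart_open_image:
  assumes "is_chart X (U, \<phi>)" "openin X V"
  shows "open (\<phi> ` (U \<inter> V))"
proof -
  have c: "open (\<phi> ` U)" "homeomorphic_map (subtopology X U) (top_of_set (\<phi> ` U)) \<phi>"
    using assms(1) unfolding is_chart_def by auto
  have "openin (subtopology X U) (U \<inter> V)"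
    using assms(2) by (metis inf_commute openin_subtopology_Int)
  then have "openin (top_of_set (\<phi> ` U)) (\<phi> ` (U \<inter> V))"
    using homeomorphic_imp_open_map[OF c(2)] unfolding open_map_def by blast
  then show ?thesis using c(1) openin_open_trans by blast
qed

text \<open>The chain rule for the transition map: near \<open>\<psi> x\<close> the embedding read in \<open>(V, \<psi>)\<close> factors
  through the embedding read in \<open>(U, \<phi>)\<close>.\<close>

lemma chart_derivative_range_subset:
  assumes A: "smooth_atlas X A" and \<iota>: "smooth_map_on_manifold A \<iota>"
    and U: "(U, \<phi>) \<in> A" "x \<in> U" and V: "(V, \<psi>) \<in> A" "x \<in> V"
  shows "range (chart_derivative \<iota> V \<psi> (\<psi> x)) \<subseteq> range (chart_derivative \<iota> U \<phi> (\<phi> x))"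
proof -
  have cU: "is_chart X (U, \<phi>)" and cV: "is_chart X (V, \<psi>)"
    using A U V unfolding smooth_atlas_def by auto
  have inj: "inj_on \<phi> U" "inj_on \<psi> V" using is_chart_inj_on cU cV by blast+
  let ?\<tau> = "\<phi> \<circ> inv_into V \<psi>"
  let ?W = "\<psi> ` (V \<inter> U)"
  have W: "open ?W" using is_chart_open_image[OF cV] cU unfolding is_chart_def by auto
  have xW: "\<psi> x \<in> ?W" using U V by auto
  have "smooth_on ?W ?\<tau>" using A U V unfolding smooth_atlas_def by fast
  then have \<tau>: "(?\<tau> has_derivative frechet_derivative ?\<tau> (at (\<psi> x))) (at (\<psi> x))"
    using smooth_on_has_derivative xW by blast
  have \<tau>x: "?\<tau> (\<psi> x) = \<phi> x" using inj V by simp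
  have "smooth_on (\<phi> ` U) (\<iota> \<circ> inv_into U \<phi>)"
    using \<iota> U unfolding smooth_map_on_manifold_def by auto
  then have "((\<iota> \<circ> inv_into U \<phi>) has_derivative chart_derivative \<iota> U \<phi> (\<phi> x)) (at (?\<tau> (\<psi> x)))"
    using smooth_on_has_derivative U \<tau>x by fastforce
  from diff_chain_at[OF \<tau> this]
  have "((\<iota> \<circ> inv_into U \<phi>) \<circ> ?\<tau> has_derivative
      chart_derivative \<iota> U \<phi> (\<phi> x) \<circ> frechet_derivative ?\<tau> (at (\<psi> x))) (at (\<psi> x))" .
  then have "((\<iota> \<circ> inv_into V \<psi>) has_derivative
      chart_derivative \<iota> U \<phi> (\<phi> x) \<circ> frechet_derivative ?\<tau> (at (\<psi> x))) (at (\<psi> x))"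
    by (rule has_derivative_transform_within_open[OF _ W xW]) (use inj in auto)
  then have "chart_derivative \<iota> V \<psi> (\<psi> x) =
      chart_derivative \<iota> U \<phi> (\<phi> x) \<circ> frechet_derivative ?\<tau> (at (\<psi> x))"
    using frechet_derivative_at by metis
  then show ?thesis by auto
qed

lemma tangent_space_chart:
  assumes "smooth_atlas X A" "smooth_map_on_manifold A \<iota>" "(U, \<phi>) \<in> A" "x \<in> U"
  shows "tangent_space A \<iota> x = range (chart_derivative \<iota> U \<phi> (\<phi> x))"
proof
  show "tangent_space A \<iota> x \<subseteq> range (chart_derivative \<iota> U \<phi> (\<phi> x))"
    unfolding tangent_space_def
    by (intro UN_least) (clarify, rule subsetD[OF chart_derivative_range_subset[OF assms]], auto)
  show "range (chart_derivative \<iota> U \<phi> (\<phi> x)) \<subseteq> tangent_space A \<iota> x"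
    unfolding tangent_space_def using assms(3,4) by auto
qed

text \<open>The index set \<open>B\<close> is a basis of the model space, so that the vectors to be dualised are the
  coordinate fields in the directions \<open>b \<in> B\<close>; it is empty when the manifold has dimension 0.\<close>

lemma chart_dual_family_exists:
  fixes A :: "('a, 'm::real_normed_vector) chart set" and \<iota> :: "'a \<Rightarrow> 'e::euclidean_space"
  assumes M: "smooth_manifold X A" and \<iota>: "smooth_embedding X A \<iota>" and U: "(U, \<phi>) \<in> A"
  obtains B :: "'m set" and c where "finite B"
    and "\<And>b. b \<in> B \<Longrightarrow> smooth_on (\<phi> ` U) (c b)"
    and "\<And>x. x \<in> U \<Longrightarrow> tangent_space A \<iota> x = span (chart_derivative \<iota> U \<phi> (\<phi> x) ` B)"
    and "\<And>x. x \<in> U \<Longrightarrow>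
      dual_family B (chart_derivative \<iota> U \<phi> (\<phi> x)) (\<lambda>b. c b (\<phi> x))"
proof -
  obtain B0 :: "'m set" where B0: "finite B0" "span B0 = UNIV"
    using M unfolding smooth_manifold_def by auto
  obtain B where B: "B \<subseteq> B0" "independent B" "B0 \<subseteq> span B"
    using maximal_independent_subset[of B0] by blast
  have fin: "finite B" using B(1) B0(1) finite_subset by blast
  have sp: "span B = UNIV" using B(3) B0(2) by (metis span_mono span_span top.extremum_unique)
  have A: "smooth_atlas X A" using M unfolding smooth_manifold_def by blast
  have \<iota>s: "smooth_map_on_manifold A \<iota>" using \<iota> unfolding smooth_embedding_def by blast
  have S: "open (\<phi> ` U)" using A U unfolding smooth_atlas_def is_chart_def by auto
  have sm: "smooth_on (\<phi> ` U) (\<iota> \<circ> inv_into U \<phi>)"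
    using \<iota>s U unfolding smooth_map_on_manifold_def by auto
  have lin: "linear (chart_derivative \<iota> U \<phi> u)" if "u \<in> \<phi> ` U" for u
    using smooth_on_has_derivative[OF sm that] has_derivative_linear by blast
  have inj: "inj (chart_derivative \<iota> U \<phi> u)" if "u \<in> \<phi> ` U" for u
    using \<iota> U that unfolding smooth_embedding_def by auto
  have "\<exists>c. (\<forall>b\<in>B. smooth_on (\<phi> ` U) (c b)) \<and>
      (\<forall>u\<in>\<phi> ` U. dual_family B (chart_derivative \<iota> U \<phi> u) (\<lambda>b. c b u))"
  proof (rule smooth_dual_family_exists[OF S fin, where f = "\<lambda>b u. chart_derivative \<iota> U \<phi> u b"])
    show "smooth_on (\<phi> ` U) (\<lambda>u. chart_derivative \<iota> U \<phi> u b)" for b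
      by (rule smooth_on_derivative[OF sm])
    show "inj_on (chart_derivative \<iota> U \<phi> u) B" if "u \<in> \<phi> ` U" for u
      using inj[OF that] inj_on_subset by blast
    show "independent (chart_derivative \<iota> U \<phi> u ` B)" if "u \<in> \<phi> ` U" for u
      by (rule linear_independent_injective_image[OF lin[OF that] B(2)])
         (use inj[OF that] inj_on_subset in blast)
  qed
  then obtain c where c: "\<And>b. b \<in> B \<Longrightarrow> smooth_on (\<phi> ` U) (c b)"
    "\<And>u. u \<in> \<phi> ` U \<Longrightarrow> dual_family B (chart_derivative \<iota> U \<phi> u) (\<lambda>b. c b u)" by blast
  show ?thesis
  proof (rule that[OF fin c(1)])
    show "tangent_space A \<iota> x = span (chart_derivative \<iota> U \<phi> (\<phi> x) ` B)" if "x \<in> U" for x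
      using tangent_space_chart[OF A \<iota>s U that] linear_span_image[OF lin, of "\<phi> x" B] that sp
      by simp
  qed (use c(2) in auto)
qed


section \<open>The projection and the metric operator are smooth\<close>

lemma smooth_tangent_projection:
  fixes A :: "('a, 'm::real_normed_vector) chart set" and \<iota> :: "'a \<Rightarrow> 'e::euclidean_space"
  assumes M: "smooth_manifold X A" and \<iota>: "smooth_embedding X A \<iota>"
  shows "smooth_map_on_manifold A (\<lambda>x. orthogonal_projection (tangent_space A \<iota> x))"
  unfolding smooth_map_on_manifold_def
proof (clarify)
  fix U \<phi> assume U: "(U, \<phi>) \<in> A"
  have chart: "is_chart X (U, \<phi>)" using M U unfolding smooth_manifold_def smooth_atlas_def by auto
  have S: "open (\<phi> ` U)" using chart unfolding is_chart_def by auto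
  have inv: "inv_into U \<phi> (\<phi> x) = x" if "x \<in> U" for x
    using is_chart_inj_on[OF chart] that by simp
  obtain B c where B: "finite B" and c: "\<And>b. b \<in> B \<Longrightarrow> smooth_on (\<phi> ` U) (c b)"
    and T: "\<And>x. x \<in> U \<Longrightarrow> tangent_space A \<iota> x = span (chart_derivative \<iota> U \<phi> (\<phi> x) ` B)"
    and d: "\<And>x. x \<in> U \<Longrightarrow> dual_family B (chart_derivative \<iota> U \<phi> (\<phi> x)) (\<lambda>b. c b (\<phi> x))"
    using chart_dual_family_exists[OF M \<iota> U] by blast
  have sm: "smooth_on (\<phi> ` U) (\<iota> \<circ> inv_into U \<phi>)"
    using \<iota> U unfolding smooth_embedding_def smooth_map_on_manifold_def by auto
  have "smooth_on (\<phi> ` U) (\<lambda>u. \<Sum>b\<in>B. rank_one (chart_derivative \<iota> U \<phi> u b) (c b u))"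
    using S c by (intro smooth_on_sum smooth_on_rank_one smooth_on_derivative sm) auto
  then show "smooth_on (\<phi> ` U) ((\<lambda>x. orthogonal_projection (tangent_space A \<iota> x)) \<circ> inv_into U \<phi>)"
    by (rule smooth_on_cong[OF S, rotated])
       (use T orthogonal_projection_dual_family[OF B d] inv in auto)
qed

text \<open>The metric operator is only a function on the tangent space, which varies with the point.
  Composed with the projection it becomes an operator on the whole ambient space, and smoothness
  makes sense for it.\<close>

definition tangent_metric_operator ::
    "('a, 'm::real_normed_vector) chart set \<Rightarrow> ('a \<Rightarrow> 'e::euclidean_space)
      \<Rightarrow> ('a \<Rightarrow> 'e \<Rightarrow> 'e \<Rightarrow> real) \<Rightarrow> 'a \<Rightarrow> 'e \<Rightarrow>\<^sub>L 'e"
  where "tangent_metric_operator A \<iota> R x = Blinfun (\<lambda>\<omega>. metric_operator (tangent_space A \<iota> x) (R x)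
    (orthogonal_projection (tangent_space A \<iota> x) \<omega>))"

text \<open>The pointwise statements are proved together with smoothness, since all of them rest on the
  same local formula \<open>M\<close>: that \<open>Blinfun\<close> is applied to a bounded linear map, and that the
  definite description in \<open>metric_operator\<close> denotes, is seen by exhibiting \<open>M\<close>.\<close>

lemma tangent_metric_operator_smooth:
  fixes A :: "('a, 'm::real_normed_vector) chart set" and \<iota> :: "'a \<Rightarrow> 'e::euclidean_space"
  assumes M: "smooth_manifold X A" and \<iota>: "smooth_embedding X A \<iota>"
    and R: "riemannian_metric X A \<iota> R"
  shows "smooth_map_on_manifold A (tangent_metric_operator A \<iota> R)"
    and "\<And>x. x \<in> topspace X \<Longrightarrow> subspace (tangent_space A \<iota> x)"
    and "\<And>x. x \<in> topspace X \<Longrightarrow>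
      metric_operator_on (tangent_space A \<iota> x) (R x) (metric_operator (tangent_space A \<iota> x) (R x))"
    and "\<And>x \<omega>. x \<in> topspace X \<Longrightarrow> blinfun_apply (tangent_metric_operator A \<iota> R x) \<omega> =
      metric_operator (tangent_space A \<iota> x) (R x) (orthogonal_projection (tangent_space A \<iota> x) \<omega>)"
proof -
  have A: "smooth_atlas X A" using M unfolding smooth_manifold_def by blast
  have *: "smooth_on (\<phi> ` U) (tangent_metric_operator A \<iota> R \<circ> inv_into U \<phi>) \<and>
    (\<forall>x\<in>U. subspace (tangent_space A \<iota> x) \<and>
      metric_operator_on (tangent_space A \<iota> x) (R x) (metric_operator (tangent_space A \<iota> x) (R x)) \<and>
      (\<forall>\<omega>. blinfun_apply (tangent_metric_operator A \<iota> R x) \<omega> =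
        metric_operator (tangent_space A \<iota> x) (R x) (orthogonal_projection (tangent_space A \<iota> x) \<omega>)))"
    if U: "(U, \<phi>) \<in> A" for U \<phi>
  proof -
    have chart: "is_chart X (U, \<phi>)" using A U unfolding smooth_atlas_def by auto
    have S: "open (\<phi> ` U)" and UX: "U \<subseteq> topspace X"
      using chart openin_subset unfolding is_chart_def by auto
    have inv: "inv_into U \<phi> (\<phi> x) = x" if "x \<in> U" for x
      using is_chart_inj_on[OF chart] that by simp
    let ?f = "chart_derivative \<iota> U \<phi>"
    obtain B c where B: "finite B" and c: "\<And>b. b \<in> B \<Longrightarrow> smooth_on (\<phi> ` U) (c b)"
      and T: "\<And>x. x \<in> U \<Longrightarrow> tangent_space A \<iota> x = span (?f (\<phi> x) ` B)"
      and d: "\<And>x. x \<in> U \<Longrightarrow> dual_family B (?f (\<phi> x)) (\<lambda>b. c b (\<phi> x))"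
      using chart_dual_family_exists[OF M \<iota> U] by blast
    define M where "M u = (\<Sum>a\<in>B. \<Sum>b\<in>B. R (inv_into U \<phi> u) (?f u a) (?f u b) *\<^sub>R
      rank_one (c a u) (c b u))" for u
    have "smooth_on (\<phi> ` U) (\<lambda>u. R (inv_into U \<phi> u) (?f u v) (?f u w))" for v w
      using R U unfolding riemannian_metric_def by fast
    then have smM: "smooth_on (\<phi> ` U) M"
      unfolding M_def using S c
      by (intro smooth_on_sum smooth_on_scaleR smooth_on_rank_one) auto
    have pt: "subspace (tangent_space A \<iota> x) \<and>
      metric_operator_on (tangent_space A \<iota> x) (R x) (metric_operator (tangent_space A \<iota> x) (R x)) \<and>
      tangent_metric_operator A \<iota> R x = M (\<phi> x) \<and>
      blinfun_apply (M (\<phi> x)) = (\<lambda>\<omega>. metric_operator (tangent_space A \<iota> x) (R x)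
        (orthogonal_projection (tangent_space A \<iota> x) \<omega>))" (is "?sub \<and> ?mo \<and> ?tm \<and> ?ap")
      if x: "x \<in> U" for x
    proof -
      let ?T = "tangent_space A \<iota> x"
      show ?thesis
      proof (intro conjI)
        show sub: ?sub using T[OF x] by simp
        have "inner_product_on ?T (R x)" using R UX x unfolding riemannian_metric_def by blast
        then have mo: "metric_operator_on ?T (R x) (restrict (blinfun_apply (M (\<phi> x))) ?T)"
          unfolding M_def T[OF x] inv[OF x] by (rule metric_operator_on_dual_family[OF B d[OF x]])
        then have eq: "metric_operator ?T (R x) = restrict (blinfun_apply (M (\<phi> x))) ?T"
          by (rule metric_operator_eq[OF sub])
        then show ?mo using mo by simp
        show ap: ?ap
        proof
          fix \<omega>
          \<comment> \<open>The dual vectors are tangent, so \<open>M\<close> only sees the tangential part of \<open>\<omega>\<close>.\<close>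
          have "\<omega> \<bullet> c b (\<phi> x) = orthogonal_projection ?T \<omega> \<bullet> c b (\<phi> x)" if "b \<in> B" for b
            by (rule orthogonal_projection_inner[OF sub])
               (use d[OF x] T[OF x] that in \<open>auto simp: dual_family_def\<close>)
          then have "M (\<phi> x) \<omega> = M (\<phi> x) (orthogonal_projection ?T \<omega>)"
            by (simp add: M_def blinfun.sum_left blinfun.scaleR_left)
          then show "M (\<phi> x) \<omega> = metric_operator ?T (R x) (orthogonal_projection ?T \<omega>)"
            using orthogonal_projection_props(1)[OF sub] by (simp add: eq)
        qed
        show ?tm unfolding tangent_metric_operator_def ap[symmetric] by (rule blinfun_apply_inverse)
      qed
    qed
    have "smooth_on (\<phi> ` U) (tangent_metric_operator A \<iota> R \<circ> inv_into U \<phi>)"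
      by (rule smooth_on_cong[OF S _ smM]) (use pt inv in auto)
    then show ?thesis using pt by auto
  qed
  show "smooth_map_on_manifold A (tangent_metric_operator A \<iota> R)"
    unfolding smooth_map_on_manifold_def using * by auto
  fix x assume "x \<in> topspace X"
  then obtain U \<phi> where U: "(U, \<phi>) \<in> A" "x \<in> U"
    using A unfolding smooth_atlas_def by blast
  show "subspace (tangent_space A \<iota> x)"
    "metric_operator_on (tangent_space A \<iota> x) (R x) (metric_operator (tangent_space A \<iota> x) (R x))"
    "\<And>\<omega>. blinfun_apply (tangent_metric_operator A \<iota> R x) \<omega> =
      metric_operator (tangent_space A \<iota> x) (R x) (orthogonal_projection (tangent_space A \<iota> x) \<omega>)"
    using *[OF U(1)] U(2) by blast+
qed

theorem proposition1:
  fixes X :: "'a topology"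
    and A :: "('a, 'm::real_normed_vector) chart set"
    and \<iota> :: "'a \<Rightarrow> 'e::euclidean_space"
  assumes "smooth_manifold X A"
    and "smooth_embedding X A \<iota>"
  shows "smooth_map_on_manifold A (\<lambda>x. orthogonal_projection (tangent_space A \<iota> x)) \<and>
    (\<forall>R. riemannian_metric X A \<iota> R \<longrightarrow>
      (\<exists>g :: 'a \<Rightarrow> ('e \<Rightarrow>\<^sub>L 'e). smooth_map_on_manifold A g \<and>
         (\<forall>x\<in>topspace X. positive_definite (g x) \<and> represents_metric A \<iota> R x (g x))) \<and>
      (\<forall>x\<in>topspace X. \<exists>!h. metric_operator_on (tangent_space A \<iota> x) (R x) h) \<and>
      (\<exists>g :: 'a \<Rightarrow> ('e \<Rightarrow>\<^sub>L 'e).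
         (\<forall>x\<in>topspace X. \<forall>\<omega>. blinfun_apply (g x) \<omega> =
            (id_blinfun - orthogonal_projection (tangent_space A \<iota> x)) \<omega> +
            metric_operator (tangent_space A \<iota> x) (R x)
              (orthogonal_projection (tangent_space A \<iota> x) \<omega>)) \<and>
         smooth_map_on_manifold A g \<and>
         (\<forall>x\<in>topspace X. positive_definite (g x) \<and> represents_metric A \<iota> R x (g x))))"

proof (intro conjI allI impI)
  show P: "smooth_map_on_manifold A (\<lambda>x. orthogonal_projection (tangent_space A \<iota> x))"
    by (rule smooth_tangent_projection[OF assms])
  fix R assume R: "riemannian_metric X A \<iota> R"
  let ?T = "tangent_space A \<iota>"
  note M = tangent_metric_operator_smooth[OF assms R]
  define g where "g x = id_blinfun - orthogonal_projection (?T x) + tangent_metric_operator A \<iota> R x" for x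
  have g: "blinfun_apply (g x) \<omega> = (id_blinfun - orthogonal_projection (?T x)) \<omega>
      + metric_operator (?T x) (R x) (orthogonal_projection (?T x) \<omega>)"
    if "x \<in> topspace X" for x \<omega>
    by (simp add: g_def blinfun.add_left M(4)[OF that])
  have smooth: "smooth_map_on_manifold A g"
    unfolding smooth_map_on_manifold_def
  proof clarify
    fix U \<phi> assume U: "(U, \<phi>) \<in> A"
    then have S: "open (\<phi> ` U)"
      using assms(1) unfolding smooth_manifold_def smooth_atlas_def is_chart_def by auto
    have "smooth_on (\<phi> ` U) (\<lambda>u. orthogonal_projection (?T (inv_into U \<phi> u)))"
      "smooth_on (\<phi> ` U) (\<lambda>u. tangent_metric_operator A \<iota> R (inv_into U \<phi> u))"
      using P M(1) U unfolding smooth_map_on_manifold_def comp_def by auto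
    then show "smooth_on (\<phi> ` U) (g \<circ> inv_into U \<phi>)"
      unfolding g_def comp_def using S
      by (intro smooth_on_add smooth_on_diff smooth_on_const)
  qed
  have pd: "positive_definite (g x) \<and> represents_metric A \<iota> R x (g x)" if x: "x \<in> topspace X" for x
  proof -
    have "inner_product_on (?T x) (R x)" using R x unfolding riemannian_metric_def by blast
    note ext = metric_extension_positive_definite[OF M(2)[OF x] this M(3)[OF x] g[OF x]]
    show ?thesis using ext unfolding represents_metric_def by blast
  qed
  show "\<forall>x\<in>topspace X. \<exists>!h. metric_operator_on (?T x) (R x) h"
    using M(2,3) metric_operator_on_unique by blast
  show "\<exists>g :: 'a \<Rightarrow> ('e \<Rightarrow>\<^sub>L 'e). smooth_map_on_manifold A g \<and>
      (\<forall>x\<in>topspace X. positive_definite (g x) \<and> represents_metric A \<iota> R x (g x))"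
    using smooth pd by blast
  show "\<exists>g :: 'a \<Rightarrow> ('e \<Rightarrow>\<^sub>L 'e).
      (\<forall>x\<in>topspace X. \<forall>\<omega>. blinfun_apply (g x) \<omega> =
        (id_blinfun - orthogonal_projection (?T x)) \<omega> +
        metric_operator (?T x) (R x) (orthogonal_projection (?T x) \<omega>)) \<and>
      smooth_map_on_manifold A g \<and>
      (\<forall>x\<in>topspace X. positive_definite (g x) \<and> represents_metric A \<iota> R x (g x))"
    using g smooth pd by blast
qed

end
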